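(* Let $N>2$ and $h_2^{(N)}=\sum_{1\le i<j\le N}\sigma_z^{i}\sigma_z^{j}$ on $(\mathbb{C}^2)^{\otimes N}$. The maximum of $4\left(\langle\psi|(h_2^{(N)})^2|\psi\rangle-\langle\psi|h_2^{(N)}|\psi\rangle^2\right)$ over all symmetric product states $|\psi\rangle=|\varphi\rangle^{\otimes N}$, with $|\varphi\rangle\in\mathbb{C}^2$ a unit vector, equals $$\frac{2N(N-1)^3}{2N-3}.$$
   Context: $\sigma_z^{i}$ denotes $\sigma_z=\mathrm{diag}(1,-1)$ acting on the $i$-th qubit and as the identity on the others. The maximized quantity is the quantum Fisher information for estimating $J$ in the encoding Hamiltonian $Jh_2^{(N)}$ with pure probe $|\psi\rangle$. *)

theory Defs
  imports "HOL-Analysis.Analysis"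
begin

text \<open>
  The qubits are labelled by the elements of a finite linearly ordered type \<open>'n\<close>, so that
  \<open>N = CARD('n)\<close>.  The space of \<open>N\<close> qubits is coordinatised by its computational basis,
  which is indexed by the bit strings \<open>s :: 'n \<Rightarrow> 2\<close>: a vector of it has type
  \<open>complex ^ ('n \<Rightarrow> 2)\<close>, and the product basis vector labelled \<open>s\<close> is the tensor product over
  all qubits \<open>k\<close> of the standard basis vectors \<open>axis (s k) 1\<close> of \<open>complex ^ 2\<close>.
\<close>

type_synonym 'n qubits = "complex ^ ('n \<Rightarrow> 2)"
type_synonym 'n qubits_op = "complex ^ ('n \<Rightarrow> 2) ^ ('n \<Rightarrow> 2)"

definition tensor_vec :: "('n::finite \<Rightarrow> complex ^ 2) \<Rightarrow> 'n qubits"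
  where "tensor_vec v = (\<chi> s. \<Prod>k\<in>UNIV. v k $ s k)"

definition tensor_op :: "('n::finite \<Rightarrow> complex ^ 2 ^ 2) \<Rightarrow> 'n qubits_op"
  where "tensor_op A = (\<chi> s t. \<Prod>k\<in>UNIV. A k $ s k $ t k)"

lemma tensor_op_tensor_vec:
  "tensor_op A *v tensor_vec v = tensor_vec (\<lambda>k. A k *v v k)"
proof -
  have "(\<Sum>t\<in>UNIV. (\<Prod>k\<in>UNIV. A k $ s k $ t k) * (\<Prod>k\<in>UNIV. v k $ t k))
      = (\<Prod>k\<in>UNIV. \<Sum>b\<in>UNIV. A k $ s k $ b * v k $ b)" for s
    using prod_sum_PiE[of "UNIV :: 'a set" "\<lambda>_. UNIV :: 2 set"
        "\<lambda>k b. A k $ s k $ b * v k $ b"]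
    by (simp add: prod.distrib)
  then show ?thesis
    by (simp add: tensor_op_def tensor_vec_def matrix_vector_mult_def vec_eq_iff)
qed

lemma tensor_vec_axis: "tensor_vec (\<lambda>k. axis (s k) 1) = axis s 1"
  by (auto simp: tensor_vec_def axis_def vec_eq_iff fun_eq_iff)

definition tensor_power :: "complex ^ 2 \<Rightarrow> 'n::finite qubits"
  where "tensor_power \<phi> = tensor_vec (\<lambda>_. \<phi>)"

definition sigma_z :: "complex ^ 2 ^ 2"
  where "sigma_z = vector [vector [1, 0], vector [0, - 1]]"

definition sigma_z_at :: "'n::finite \<Rightarrow> 'n qubits_op"
  where "sigma_z_at i = tensor_op (\<lambda>k. if k = i then sigma_z else mat 1)"

definition h2 :: "'n::{finite,linorder} qubits_op"
  where "h2 = (\<Sum>(i, j) | i < j. sigma_z_at i ** sigma_z_at j)"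

definition braket :: "complex ^ 'a::finite \<Rightarrow> complex ^ 'a ^ 'a \<Rightarrow> complex ^ 'a \<Rightarrow> complex"
  where "braket \<phi> A \<psi> = (\<Sum>s\<in>UNIV. cnj (\<phi> $ s) * (A *v \<psi>) $ s)"

text \<open>
  The variance below is real for Hermitian \<open>H\<close> (in particular for \<open>h2\<close>, see
  \<open>h2_variance_real\<close>), so \<^const>\<open>Re\<close> only serves to make it an element of an ordered type.
\<close>

definition pure_qfi :: "complex ^ 'a::finite ^ 'a \<Rightarrow> complex ^ 'a \<Rightarrow> real"
  where "pure_qfi H \<psi> = 4 * Re (braket \<psi> (H ** H) \<psi> - (braket \<psi> H \<psi>)\<^sup>2)"

lemma braket_hermitian_real:
  assumes "\<And>s t. A $ s $ t = cnj (A $ t $ s)"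
  shows "braket \<psi> A \<psi> \<in> \<real>"
proof -
  have "cnj (braket \<psi> A \<psi>) = (\<Sum>s\<in>UNIV. \<Sum>t\<in>UNIV. \<psi> $ s * cnj (A $ s $ t) * cnj (\<psi> $ t))"
    by (simp add: braket_def matrix_vector_mult_def sum_distrib_left mult.assoc)
  also have "\<dots> = (\<Sum>t\<in>UNIV. \<Sum>s\<in>UNIV. cnj (\<psi> $ t) * (A $ t $ s * \<psi> $ s))"
    by (subst sum.swap) (intro sum.cong refl, subst assms, simp add: mult_ac)
  also have "\<dots> = braket \<psi> A \<psi>"
    by (simp add: braket_def matrix_vector_mult_def sum_distrib_left)
  finally show ?thesis by (simp add: Reals_cnj_iff)
qed

lemma sigma_z_at_nth:
  "sigma_z_at i $ s $ t = (if s = t then if s i = 1 then 1 else - 1 else 0)"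
proof (cases "s = t")
  case True
  have "(\<Prod>k\<in>UNIV. (if k = i then sigma_z else mat 1) $ s k $ s k)
      = (\<Prod>k\<in>UNIV. if k = i then sigma_z $ s i $ s i else 1)"
    by (intro prod.cong) (auto simp: mat_def)
  then show ?thesis
    using True exhaust_2[of "s i"]
    by (auto simp: sigma_z_at_def tensor_op_def sigma_z_def vector_2)
next
  case False
  then obtain k where k: "s k \<noteq> t k" by auto
  then have "(if k = i then sigma_z else mat 1) $ s k $ t k = 0"
    using exhaust_2[of "s k"] exhaust_2[of "t k"]
    by (auto simp: mat_def sigma_z_def vector_2)
  then have "(\<Prod>k\<in>UNIV. (if k = i then sigma_z else mat 1) $ s k $ t k) = 0"
    by (intro prod_zero finite bexI[of _ k] UNIV_I)
  then show ?thesis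
    using False by (simp add: sigma_z_at_def tensor_op_def)
qed

lemma h2_hermitian: "h2 $ s $ t = cnj (h2 $ t $ s)"
proof -
  have "sigma_z_at i $ s $ u * sigma_z_at j $ u $ t
      = cnj (sigma_z_at i $ t $ u * sigma_z_at j $ u $ s)" for i j :: 'a and u
    by (simp add: sigma_z_at_nth)
  then have "(sigma_z_at i ** sigma_z_at j) $ s $ t = cnj ((sigma_z_at i ** sigma_z_at j) $ t $ s)"
    for i j :: 'a
    by (simp only: matrix_matrix_mult_def vec_lambda_beta cnj_sum)
  then show ?thesis
    by (simp only: h2_def sum_component case_prod_unfold cnj_sum)
qed

lemma h2_variance_real:
  fixes \<psi> :: "'n::{finite,linorder} qubits"
  shows "braket \<psi> (h2 ** h2) \<psi> - (braket \<psi> h2 \<psi>)\<^sup>2 \<in> \<real>"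
proof -
  have eq: "h2 $ s $ u * h2 $ u $ t = cnj (h2 $ t $ u * h2 $ u $ s)" for s t u :: "'n \<Rightarrow> 2"
  proof -
    have "cnj (h2 $ t $ u * h2 $ u $ s) = cnj (h2 $ t $ u) * cnj (h2 $ u $ s)"
      by (rule complex_cnj_mult)
    also have "\<dots> = h2 $ u $ t * h2 $ s $ u"
      by (rule arg_cong2[of _ _ _ _ "(*)"]) (rule h2_hermitian[symmetric])+
    finally show ?thesis by (simp only: mult.commute)
  qed
  have "(h2 ** h2) $ s $ t = cnj ((h2 ** h2) $ t $ s)" for s t :: "'n \<Rightarrow> 2"
    unfolding matrix_matrix_mult_def vec_lambda_beta cnj_sum by (rule sum.cong[OF refl eq])
  then have "braket \<psi> (h2 ** h2) \<psi> \<in> \<real>"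
    by (rule braket_hermitian_real)
  moreover have "braket \<psi> h2 \<psi> \<in> \<real>"
    by (rule braket_hermitian_real) (rule h2_hermitian)
  ultimately show ?thesis
    by (intro Reals_diff Reals_power)
qed

end

theory Submission
  imports Defs
begin

text \<open>
  The operator \<^const>\<open>h2\<close> is diagonal, so on \<^term>\<open>tensor_power \<phi>\<close> its variance is that of
  \<open>\<Sum>i<j. X\<^sub>i X\<^sub>j = (M\<^sup>2 - N) / 2\<close>, where the \<open>X\<^sub>i\<close> are independent signs of mean
  \<open>m = \<bar>\<phi>\<^sub>1\<bar>\<^sup>2 - \<bar>\<phi>\<^sub>2\<bar>\<^sup>2\<close> and \<open>M = \<Sum>i. X\<^sub>i\<close>.  Hence the quantum Fisher information is
  \<open>E M\<^sup>4 - (E M\<^sup>2)\<^sup>2 = 2 N (N - 1) (1 + 2 (N - 2) x - (2 N - 3) x\<^sup>2)\<close> with \<open>x = m\<^sup>2\<close>, and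
  this quadratic function attains its maximum at \<open>x = (N - 2) / (2 N - 3) \<in> [0, 1]\<close>.
\<close>

definition spin :: "2 \<Rightarrow> real"
  where "spin b = (if b = 1 then 1 else - 1)"

text \<open>Expectation over independent bits that all have distribution \<open>w\<close>. With
  \<open>w b = (cmod (\<phi> $ b))\<^sup>2\<close> it gives the measurement statistics of
  \<open>tensor_power \<phi>\<close> in the computational basis.\<close>

definition expect :: "(2 \<Rightarrow> real) \<Rightarrow> (('n::finite \<Rightarrow> 2) \<Rightarrow> real) \<Rightarrow> real"
  where "expect w f = (\<Sum>s\<in>UNIV. (\<Prod>k\<in>UNIV. w (s k)) * f s)"

lemma spin_mult_self [simp]: "spin b * spin b = 1"
  by (simp add: spin_def)

lemma spin_power2 [simp]: "(spin b)\<^sup>2 = 1"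
  by (simp add: spin_def)

lemma expect_add: "expect w (\<lambda>s. f s + g s) = expect w f + expect w g"
  by (simp add: expect_def algebra_simps sum.distrib)

lemma expect_cmult: "expect w (\<lambda>s. c * f s) = c * expect w f"
  by (simp add: expect_def sum_distrib_left mult_ac)

lemma expect_const:
  assumes "w 1 + w 2 = 1"
  shows "expect w (\<lambda>s :: 'n::finite \<Rightarrow> 2. c) = c"
proof -
  have "(\<Sum>s\<in>(UNIV :: ('n \<Rightarrow> 2) set). \<Prod>k\<in>UNIV. w (s k)) = (\<Prod>k\<in>(UNIV::'n set). \<Sum>b\<in>UNIV. w b)"
    using prod_sum_PiE[of "UNIV :: 'n set" "\<lambda>_. UNIV :: 2 set" "\<lambda>_. w"] by simp
  then show ?thesis
    using assms by (simp add: expect_def UNIV_2 flip: sum_distrib_right)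
qed

text \<open>Independence: \<open>f\<close> ignores bit \<open>i\<close>, so the sign at
  \<open>i\<close> factors out with its mean. Flipping bit \<open>i\<close> is an involution that
  negates the weighted summand \<open>G\<close> of the centred sign, so the sum of \<open>G\<close>
  equals its own negative.\<close>

lemma expect_spin_mult:
  fixes f :: "('n::finite \<Rightarrow> 2) \<Rightarrow> real"
  assumes w: "w 1 + w 2 = 1" and f: "\<And>s b. f (s(i := b)) = f s"
  shows "expect w (\<lambda>s. spin (s i) * f s) = (w 1 - w 2) * expect w f"
proof -
  define m where "m = w 1 - w 2"
  define flip where "flip s = s(i := if s i = 1 then 2 else 1)" for s :: "'n \<Rightarrow> 2"
  define G where "G s = (\<Prod>k\<in>UNIV. w (s k)) * ((spin (s i) - m) * f s)" for s
  have split: "(\<Prod>k\<in>UNIV. w (s k)) = w (s i) * (\<Prod>k\<in>UNIV - {i}. w (s k))" for s :: "'n \<Rightarrow> 2"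
    by (simp add: prod.remove[of UNIV i])
  \<comment> \<open>\<open>w b * (spin b - m)\<close> equals \<open>2 * w 1 * w 2\<close> for \<open>b = 1\<close> and its negative for \<open>b = 2\<close>.\<close>
  have w2: "w 2 = 1 - w 1" using w by simp
  have anti: "G (flip s) = - G s" for s
  proof -
    have rest: "(\<Prod>k\<in>UNIV - {i}. w (flip s k)) = (\<Prod>k\<in>UNIV - {i}. w (s k))"
      by (intro prod.cong) (auto simp: flip_def)
    have "w (flip s i) * (spin (flip s i) - m) = - (w (s i) * (spin (s i) - m))"
      using exhaust_2[of "s i"]
      by (auto simp: flip_def spin_def m_def w2 algebra_simps)
    then have "w (flip s i) * (spin (flip s i) - m) * (\<Prod>k\<in>UNIV - {i}. w (s k)) * f s
        = - (w (s i) * (spin (s i) - m)) * (\<Prod>k\<in>UNIV - {i}. w (s k)) * f s"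
      by simp
    moreover have "f (flip s) = f s" by (simp add: flip_def f)
    ultimately show ?thesis
      unfolding G_def split rest by (simp add: mult_ac)
  qed
  have flip_flip: "flip (flip s) = s" for s
    using exhaust_2[of "s i"] by (auto simp: flip_def)
  have "(\<Sum>s\<in>UNIV. G s) = (\<Sum>s\<in>UNIV. G (flip s))"
    by (rule sum.reindex_bij_witness[of _ flip flip]) (auto simp: flip_flip)
  also have "\<dots> = - (\<Sum>s\<in>UNIV. G s)"
    by (simp add: anti sum_negf)
  finally have "expect w (\<lambda>s. (spin (s i) - m) * f s) = 0"
    by (simp add: G_def expect_def)
  moreover have "expect w (\<lambda>s. spin (s i) * f s)
      = expect w (\<lambda>s. (spin (s i) - m) * f s) + m * expect w f"
    by (simp add: algebra_simps flip: expect_add expect_cmult)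
  ultimately show ?thesis by (simp add: m_def)
qed

text \<open>Induction over subsets \<open>A\<close> makes each new sign independent of
  \<open>M A\<close>. The four moments go together because the third and fourth draw on lower ones
  in the inductive step.\<close>

lemma expect_spin_sum_powers:
  fixes A :: "'n::finite set" and w :: "2 \<Rightarrow> real"
  defines "m \<equiv> w 1 - w 2" and "M \<equiv> \<lambda>A s. \<Sum>i\<in>A. spin (s i)"
  assumes w: "w 1 + w 2 = 1"
  shows "expect w (\<lambda>s. M A s) = real (card A) * m \<and>
    expect w (\<lambda>s. M A s ^ 2) = real (card A) + real (card A) * (real (card A) - 1) * m ^ 2 \<and>
    expect w (\<lambda>s. M A s ^ 3) = (3 * real (card A) ^ 2 - 2 * real (card A)) * m
      + real (card A) * (real (card A) - 1) * (real (card A) - 2) * m ^ 3 \<and>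
    expect w (\<lambda>s. M A s ^ 4) = 3 * real (card A) ^ 2 - 2 * real (card A)
      + real (card A) * (real (card A) - 1) * (6 * real (card A) - 8) * m ^ 2
      + real (card A) * (real (card A) - 1) * (real (card A) - 2) * (real (card A) - 3) * m ^ 4"
  using finite[of A]
proof (induction A rule: finite_induct)
  case empty
  then show ?case by (simp add: M_def expect_const[OF w])
next
  case (insert i A)
  let ?n = "real (card A)"
  have M: "M (insert i A) s = spin (s i) + M A s" for s
    using insert.hyps by (simp add: M_def)
  have indep: "expect w (\<lambda>s. spin (s i) * M A s ^ r) = m * expect w (\<lambda>s. M A s ^ r)" for r
    unfolding m_def
  proof (rule expect_spin_mult[OF w])
    have "M A (s(i := b)) = M A s" for s b
      using insert.hyps unfolding M_def by (intro sum.cong) auto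
    then show "M A (s(i := b)) ^ r = M A s ^ r" for s b by simp
  qed
  have mean: "expect w (\<lambda>s. spin (s i)) = m"
    using indep[of 0] by (simp add: expect_const[OF w])
  have indep1: "expect w (\<lambda>s. spin (s i) * M A s) = m * expect w (\<lambda>s. M A s)"
    using indep[of 1] by simp
  \<comment> \<open>Reducing by \<open>e\<^sup>2 = 1\<close> leaves every monomial of degree at most
    one in the new sign \<open>e\<close>, the form to which \<open>indep\<close> applies.\<close>
  have e2: "(e + y) ^ 2 = 1 + 2 * (e * y) + y ^ 2"
    and e3: "(e + y) ^ 3 = e + 3 * y + 3 * (e * y ^ 2) + y ^ 3"
    and e4: "(e + y) ^ 4 = 1 + 4 * (e * y) + 6 * y ^ 2 + 4 * (e * y ^ 3) + y ^ 4"
    if "e\<^sup>2 = 1" for e y :: real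
    using that by algebra+
  have card: "real (card (insert i A)) = ?n + 1"
    using insert.hyps by simp
  show ?case
    unfolding M card e2[OF spin_power2] e3[OF spin_power2] e4[OF spin_power2]
      expect_add expect_cmult indep indep1 mean expect_const[OF w]
      insert.IH[THEN conjunct1] insert.IH[THEN conjunct2, THEN conjunct1]
      insert.IH[THEN conjunct2, THEN conjunct2, THEN conjunct1]
      insert.IH[THEN conjunct2, THEN conjunct2, THEN conjunct2]
    by (intro conjI) algebra+
qed

text \<open>Only even moments enter, and these are polynomials in the squared mean \<open>x\<close>;
  hence a quadratic in \<open>x\<close>.\<close>

lemma variance_spin_sum_square:
  fixes w :: "2 \<Rightarrow> real"
  defines "x \<equiv> (w 1 - w 2)\<^sup>2" and "N \<equiv> real CARD('n::finite)"
    and "M \<equiv> \<lambda>s :: 'n \<Rightarrow> 2. \<Sum>i\<in>UNIV. spin (s i)"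
  assumes w: "w 1 + w 2 = 1"
  shows "expect w (\<lambda>s. M s ^ 4) - (expect w (\<lambda>s. M s ^ 2))\<^sup>2
    = 2 * N * (N - 1) * (1 + 2 * (N - 2) * x - (2 * N - 3) * x\<^sup>2)"
  using expect_spin_sum_powers[OF w, of "UNIV :: 'n set"]
  unfolding M_def x_def N_def by (elim conjE) algebra

text \<open>Products of diagonal matrices are diagonal. Expanding the squared sum of signs over
  ordered pairs gives two equal halves \<open>i < j\<close> and \<open>j < i\<close>, plus a
  diagonal where each sign squares to 1.\<close>

lemma h2_nth:
  fixes s t :: "'n::{finite,linorder} \<Rightarrow> 2"
  shows "h2 $ s $ t =
    (if s = t then of_real (((\<Sum>i\<in>UNIV. spin (s i))\<^sup>2 - real CARD('n)) / 2) else 0)"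
proof -
  have sz: "sigma_z_at i $ s $ t = (if s = t then of_real (spin (s i)) else 0)"
    for i :: 'n and s t :: "'n \<Rightarrow> 2"
    by (simp add: sigma_z_at_nth spin_def)
  have "(sigma_z_at i ** sigma_z_at j) $ s $ t
      = (if s = t then of_real (spin (s i) * spin (s j)) else 0)" for i j :: 'n
    by (simp add: matrix_matrix_mult_def sz if_distrib[of "\<lambda>x. x * _"] cong: if_cong)
  then have h: "h2 $ s $ t =
      (if s = t then of_real (\<Sum>(i, j) | i < j. spin (s i) * spin (s j)) else 0)"
    by (simp add: h2_def case_prod_unfold)
  let ?f = "\<lambda>(i, j). spin (s i) * spin (s j)"
  have "(\<Sum>i\<in>UNIV. spin (s i))\<^sup>2 = sum ?f UNIV"
    by (simp add: power2_eq_square sum_product sum.cartesian_product)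
  also have "UNIV = {(i, j). i < j} \<union> ({(i, j). j < i} \<union> {(i, j). i = (j::'n)})"
    by auto
  also have "sum ?f \<dots> = sum ?f {(i, j). i < j} + (sum ?f {(i, j). j < i} + sum ?f {(i, j). i = j})"
    by (subst sum.union_disjoint; (subst sum.union_disjoint)?) auto
  also have "sum ?f {(i, j). j < i} = sum ?f {(i, j). i < j}"
    by (rule sum.reindex_bij_witness[of _ prod.swap prod.swap]) auto
  also have "sum ?f {(i, j). i = j} = (\<Sum>i\<in>(UNIV::'n set). 1)"
    by (rule sum.reindex_bij_witness[of _ "\<lambda>i. (i, i)" fst]) auto
  finally have "(\<Sum>(i, j) | i < j. spin (s i) * spin (s j))
      = ((\<Sum>i\<in>UNIV. spin (s i))\<^sup>2 - real CARD('n)) / 2"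
    by simp
  then show ?thesis unfolding h by (simp only:)
qed

text \<open>A diagonal operator sees only the squared moduli of the amplitudes, and for a product
  state these factor over the qubits.\<close>

lemma braket_diagonal_tensor_power:
  fixes A :: "'n::finite qubits_op"
  assumes "\<And>s t. A $ s $ t = (if s = t then of_real (d s) else 0)"
  shows "braket (tensor_power \<phi>) A (tensor_power \<phi>) = of_real (expect (\<lambda>b. (cmod (\<phi> $ b))\<^sup>2) d)"
proof -
  have "cnj (tensor_power \<phi> $ s) * (A *v tensor_power \<phi>) $ s
      = of_real ((\<Prod>k\<in>UNIV. (cmod (\<phi> $ s k))\<^sup>2) * d s)" for s
  proof -
    have "(A *v tensor_power \<phi>) $ s = of_real (d s) * tensor_power \<phi> $ s"
      by (simp add: matrix_vector_mult_def assms if_distrib[of "\<lambda>x. x * _"] cong: if_cong)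
    moreover have "cnj (tensor_power \<phi> $ s) * tensor_power \<phi> $ s
        = of_real (\<Prod>k\<in>UNIV. (cmod (\<phi> $ s k))\<^sup>2)"
      by (simp add: tensor_power_def tensor_vec_def mult.commute[of "cnj _"]
          flip: prod.distrib complex_norm_square)
    ultimately show ?thesis by (simp add: mult_ac)
  qed
  then show ?thesis by (simp add: braket_def expect_def)
qed

lemma pure_qfi_h2_tensor_power:
  fixes \<phi> :: "complex ^ 2"
  defines "x \<equiv> ((cmod (\<phi> $ 1))\<^sup>2 - (cmod (\<phi> $ 2))\<^sup>2)\<^sup>2"
    and "N \<equiv> real CARD('n::{finite,linorder})"
  assumes norm: "norm \<phi> = 1"
  shows "pure_qfi h2 (tensor_power \<phi> :: 'n qubits)
    = 2 * N * (N - 1) * (1 + 2 * (N - 2) * x - (2 * N - 3) * x\<^sup>2)"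
proof -
  define w where "w b = (cmod (\<phi> $ b))\<^sup>2" for b
  define M where "M s = (\<Sum>i\<in>UNIV. spin (s i))" for s :: "'n \<Rightarrow> 2"
  define d where "d s = ((M s)\<^sup>2 - N) / 2" for s
  have w: "w 1 + w 2 = 1"
    using norm by (simp add: norm_vec_def L2_set_def w_def sum_2)
  have h2: "h2 $ s $ t = (if s = t then of_real (d s) else 0)" for s t :: "'n \<Rightarrow> 2"
    by (simp only: h2_nth d_def M_def N_def)
  have h2h2: "(h2 ** h2) $ s $ t = (if s = t then of_real ((d s)\<^sup>2) else 0)"
    for s t :: "'n \<Rightarrow> 2"
    by (simp add: matrix_matrix_mult_def h2 power2_eq_square if_distrib[of "\<lambda>x. x * _"]
        cong: if_cong)
  have "pure_qfi h2 (tensor_power \<phi> :: 'n qubits)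
      = 4 * (expect w (\<lambda>s. (d s)\<^sup>2) - (expect w d)\<^sup>2)"
    unfolding pure_qfi_def braket_diagonal_tensor_power[OF h2]
      braket_diagonal_tensor_power[of _ "\<lambda>s. (d s)\<^sup>2", OF h2h2] w_def
    by (simp flip: of_real_power of_real_diff)
  \<comment> \<open>The square is written as an affine combination of \<open>M s ^ 4\<close> and
    \<open>M s ^ 2\<close>, ready for linearity.\<close>
  also have "expect w (\<lambda>s. (d s)\<^sup>2)
      = expect w (\<lambda>s. 1/4 * M s ^ 4 + ((- N/2) * M s ^ 2 + N\<^sup>2 / 4))"
    by (rule arg_cong[of _ _ "expect w"])
      (simp add: fun_eq_iff d_def field_simps power2_eq_square power4_eq_xxxx)
  also have "\<dots> = 1/4 * expect w (\<lambda>s. M s ^ 4) + ((- N/2) * expect w (\<lambda>s. M s ^ 2) + N\<^sup>2 / 4)"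
    unfolding expect_add expect_cmult expect_const[OF w] ..
  also have "expect w d = expect w (\<lambda>s. 1/2 * (M s)\<^sup>2 + (- N/2))"
    by (rule arg_cong[of _ _ "expect w"]) (simp add: fun_eq_iff d_def field_simps)
  also have "\<dots> = 1/2 * expect w (\<lambda>s. (M s)\<^sup>2) + (- N/2)"
    unfolding expect_add expect_cmult expect_const[OF w] ..
  \<comment> \<open>The shift by \<open>- N/2\<close> drops out of the variance, and the prefactor 4
    cancels the squared factor \<open>1/2\<close>.\<close>
  finally have "pure_qfi h2 (tensor_power \<phi> :: 'n qubits)
      = expect w (\<lambda>s. M s ^ 4) - (expect w (\<lambda>s. (M s)\<^sup>2))\<^sup>2"
    by (simp add: field_simps power2_eq_square)
  also have "\<dots> = 2 * N * (N - 1) * (1 + 2 * (N - 2) * x - (2 * N - 3) * x\<^sup>2)"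
    using variance_spin_sum_square[OF w, where 'n = 'n]
    by (simp only: M_def N_def x_def w_def[of 1] w_def[of 2])
  finally show ?thesis .
qed

text \<open>Completing the square: the gap to the maximum is a positive multiple of
  \<open>((2 * N - 3) * x - (N - 2))\<^sup>2\<close>, since \<open>N > 2\<close> makes
  \<open>N\<close>, \<open>N - 1\<close> and \<open>2 * N - 3\<close> positive.\<close>

lemma qfi_polynomial_max:
  fixes N x :: real
  assumes "N > 2"
  shows "2 * N * (N - 1) * (1 + 2 * (N - 2) * x - (2 * N - 3) * x\<^sup>2)
      \<le> 2 * N * (N - 1) ^ 3 / (2 * N - 3)" (is "?l \<le> ?r")
    and "x = (N - 2) / (2 * N - 3) \<Longrightarrow>
      2 * N * (N - 1) * (1 + 2 * (N - 2) * x - (2 * N - 3) * x\<^sup>2)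
      = 2 * N * (N - 1) ^ 3 / (2 * N - 3)"
proof -
  have nz: "2 * N - 3 \<noteq> 0" using assms by simp
  have "?r - 2 * N * (N - 1) * ((2 * N - 3) * x - (N - 2))\<^sup>2 / (2 * N - 3)
      = (2 * N * (N - 1) ^ 3 - 2 * N * (N - 1) * ((2 * N - 3) * x - (N - 2))\<^sup>2) / (2 * N - 3)"
    by (simp add: diff_divide_distrib)
  \<comment> \<open>The constant terms match because
    \<open>(N - 1)\<^sup>2 - (N - 2)\<^sup>2 = 2 * N - 3\<close>.\<close>
  also have "2 * N * (N - 1) ^ 3 - 2 * N * (N - 1) * ((2 * N - 3) * x - (N - 2))\<^sup>2 = ?l * (2 * N - 3)"
    by algebra
  finally have eq: "?l = ?r - 2 * N * (N - 1) * ((2 * N - 3) * x - (N - 2))\<^sup>2 / (2 * N - 3)"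
    using nz by simp
  show "?l \<le> ?r" unfolding eq using assms by simp
  show "?l = ?r" if "x = (N - 2) / (2 * N - 3)"
    unfolding eq using that nz by simp
qed

theorem mainTheorem7:
  fixes N :: nat
    and S :: "'n::{finite,linorder} qubits set"
  assumes "N = CARD('n)"
    and "N > 2"
    and "S = {tensor_power \<phi> | \<phi>. norm \<phi> = 1}"
  shows "(\<exists>\<psi>\<in>S. pure_qfi h2 \<psi> = 2 * real N * (real N - 1) ^ 3 / (2 * real N - 3))
    \<and> (\<forall>\<psi>\<in>S. pure_qfi h2 \<psi> \<le> 2 * real N * (real N - 1) ^ 3 / (2 * real N - 3))"
proof
  have N: "real N > 2" using assms(2) by simp
  \<comment> \<open>The vertex of the quadratic. It lies in \<open>[0, 1]\<close>, so its root
    \<open>m\<close> is the mean of a genuine sign distribution.\<close>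
  define x where "x = (real N - 2) / (2 * real N - 3)"
  define m where "m = sqrt x"
  have x: "0 \<le> x" "x \<le> 1" using N by (simp_all add: x_def field_simps)
  then have m: "0 \<le> m" "m \<le> 1" "m\<^sup>2 = x" by (simp_all add: m_def)
  \<comment> \<open>Real amplitudes chosen so that the two probabilities sum to 1 and differ by
    \<open>m\<close>.\<close>
  define \<phi> :: "complex ^ 2"
    where "\<phi> = vector [of_real (sqrt ((1 + m) / 2)), of_real (sqrt ((1 - m) / 2))]"
  have \<phi>: "(cmod (\<phi> $ 1))\<^sup>2 = (1 + m) / 2" "(cmod (\<phi> $ 2))\<^sup>2 = (1 - m) / 2"
    using m by (simp_all add: \<phi>_def vector_2)
  have norm: "norm \<phi> = 1"
    unfolding norm_vec_def L2_set_def sum_2 \<phi> by (simp add: field_simps)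
  have "((cmod (\<phi> $ 1))\<^sup>2 - (cmod (\<phi> $ 2))\<^sup>2)\<^sup>2 = x"
    unfolding \<phi> using m(3) by (simp add: field_simps)
  then have "pure_qfi h2 (tensor_power \<phi> :: 'n qubits)
      = 2 * real N * (real N - 1) ^ 3 / (2 * real N - 3)"
    using qfi_polynomial_max(2)[OF N x_def]
    by (simp add: pure_qfi_h2_tensor_power[OF norm] assms(1))
  then show "\<exists>\<psi>\<in>S. pure_qfi h2 \<psi> = 2 * real N * (real N - 1) ^ 3 / (2 * real N - 3)"
    using norm assms(3) by blast
  \<comment> \<open>The polynomial bound holds at every real \<open>x\<close>, in particular at the
    squared mean of any state in \<open>S\<close>.\<close>
  show "\<forall>\<psi>\<in>S. pure_qfi h2 \<psi> \<le> 2 * real N * (real N - 1) ^ 3 / (2 * real N - 3)"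
    using qfi_polynomial_max(1)[OF N] assms(1,3) by (auto simp only: pure_qfi_h2_tensor_power)
qed

end
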